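(* Suppose $\boldsymbol\theta_0=(\eta_0,\boldsymbol\xi_0^\top)^\top\in\Theta$ is the true parameter, with $\mathbf Z=G_z(\boldsymbol\theta_0,\mathbf U)$. Let $T^P$ be the profile nuclear mapping function for the target parameter $\eta$, and for $0<\alpha<1$ define $$\Xi_\alpha(\mathbf z)=\Big\{\eta:\exists\,\mathbf u^*\in\mathcal U\text{ and }\boldsymbol\xi\text{ such that }(\eta,\boldsymbol\xi^\top)^\top\in\Theta,\ \mathbf z=G_z\big((\eta,\boldsymbol\xi^\top)^\top,\mathbf u^*\big),\ T^P\big(\mathbf u^*,(\eta,\boldsymbol\xi^\top)^\top\big)\le\alpha\Big\}.$$ Then $\mathbb P\{\eta_0\in\Xi_\alpha(\mathbf Z)\}\ge\alpha$.
   Context: $\mathbf U$ is a random vector in $\mathcal U\subset\mathbb R^r$ with known distribution, $G_z:\Theta\times\mathcal U\to\mathcal Z$ is a known mapping, and each $\boldsymbol\theta\in\Theta$ is written $\boldsymbol\theta=(\eta,\boldsymbol\xi^\top)^\top$ with target parameter $\eta$ and nuisance parameter $\boldsymbol\xi$. $T_a:\mathcal U\times\Theta\to\mathbb R^d$ is a given mapping and $B_{\alpha'}(\boldsymbol\theta)$, $0<\alpha'<1$, are Borel sets with $\mathbb P\{T_a(\mathbf U,\boldsymbol\theta)\in B_{\alpha'}(\boldsymbol\theta)\}\ge\alpha'$ for all $\boldsymbol\theta\in\Theta$. The set $\Gamma_{\alpha'}$ is $$\Gamma_{\alpha'}(\mathbf z)=\{\boldsymbol\theta\in\Theta:\exists\,\mathbf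 u^*\in\mathcal U\text{ such that }\mathbf z=G_z(\boldsymbol\theta,\mathbf u^* ),\ T_a(\mathbf u^*,\boldsymbol\theta)\in B_{\alpha'}(\boldsymbol\theta)\},$$ or, if the model is specified by a generalized equation $g(\mathbf z,\boldsymbol\theta,\mathbf u)=\mathbf 0$ satisfied by $\mathbf z=G_z(\boldsymbol\theta,\mathbf u)$, the same set with $\mathbf z=G_z(\boldsymbol\theta,\mathbf u^* )$ replaced by $g(\mathbf z,\boldsymbol\theta,\mathbf u^* )=\mathbf 0$. For $\boldsymbol\theta=(\eta,\boldsymbol\xi^\top)^\top$ put $\nu(\mathbf u;\eta,\boldsymbol\xi,\widetilde{\boldsymbol\xi})=\inf\{\alpha':(\eta,\widetilde{\boldsymbol\xi}^\top)^\top\in\Gamma_{\alpha'}(G_z(\boldsymbol\theta,\mathbf u))\}$, and the profile nuclear mapping function is $T^P(\mathbf u,\boldsymbol\theta)=\min_{\widetilde{\boldsymbol\xi}}\nu(\mathbf u;\eta,\boldsymbol\xi,\widetilde{\boldsymbol\xi})$, the minimum being over all $\widetilde{\boldsymbol\xi}$ with $(\eta,\widetilde{\boldsymbol\xi}^\top)^\top\in\Theta$ (infimum if not attained). Infima over $\alpha'$ are over $\alpha'\in(0,1)$ with the infimum of the empty set equal to $1$. Measurability of events is implicit. *)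

theory Defs
  imports "HOL-Probability.Probability"
begin

text \<open>
  A parameter \<open>\<theta> = (\<eta>, \<xi>)\<close> is a pair of a target part of type \<open>'e\<close> and a nuisance part of
  type \<open>'x\<close>; both types are arbitrary. Levels \<open>\<alpha>'\<close> are reals, and only those in the open unit
  interval matter.
\<close>

definition Gamma_map ::
  "('e \<times> 'x) set \<Rightarrow> 'u set \<Rightarrow> ('e \<times> 'x \<Rightarrow> 'u \<Rightarrow> 'z) \<Rightarrow> ('u \<Rightarrow> 'e \<times> 'x \<Rightarrow> 'v)
    \<Rightarrow> (real \<Rightarrow> 'e \<times> 'x \<Rightarrow> 'v set) \<Rightarrow> real \<Rightarrow> 'z \<Rightarrow> ('e \<times> 'x) set" where
  "Gamma_map \<Theta> \<U> G T\<^sub>a B \<alpha>' z =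
     {\<theta> \<in> \<Theta>. \<exists>u\<in>\<U>. z = G \<theta> u \<and> T\<^sub>a u \<theta> \<in> B \<alpha>' \<theta>}"

definition Gamma_eqn ::
  "('e \<times> 'x) set \<Rightarrow> 'u set \<Rightarrow> ('z \<Rightarrow> 'e \<times> 'x \<Rightarrow> 'u \<Rightarrow> 'w::zero) \<Rightarrow> ('u \<Rightarrow> 'e \<times> 'x \<Rightarrow> 'v)
    \<Rightarrow> (real \<Rightarrow> 'e \<times> 'x \<Rightarrow> 'v set) \<Rightarrow> real \<Rightarrow> 'z \<Rightarrow> ('e \<times> 'x) set" where
  "Gamma_eqn \<Theta> \<U> g T\<^sub>a B \<alpha>' z =
     {\<theta> \<in> \<Theta>. \<exists>u\<in>\<U>. g z \<theta> u = 0 \<and> T\<^sub>a u \<theta> \<in> B \<alpha>' \<theta>}"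

text \<open>
  The library leaves \<open>Inf {}\<close> unspecified on the reals; over levels in the unit interval the
  infimum of the empty set is taken to be 1.
\<close>

definition level_Inf :: "(real \<Rightarrow> bool) \<Rightarrow> real" where
  "level_Inf P =
     (let S = {\<alpha>'. 0 < \<alpha>' \<and> \<alpha>' < 1 \<and> P \<alpha>'} in if S = {} then 1 else Inf S)"

definition profile_level ::
  "(real \<Rightarrow> 'z \<Rightarrow> ('e \<times> 'x) set) \<Rightarrow> ('e \<times> 'x \<Rightarrow> 'u \<Rightarrow> 'z) \<Rightarrow> 'u \<Rightarrow> 'e \<Rightarrow> 'x \<Rightarrow> 'x \<Rightarrow> real" where
  "profile_level \<Gamma> G u \<eta> \<xi> \<xi>' = level_Inf (\<lambda>\<alpha>'. (\<eta>, \<xi>') \<in> \<Gamma> \<alpha>' (G (\<eta>, \<xi>) u))"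

text \<open>
  The minimum over the nuisance part is read as an infimum. For \<open>\<theta> \<in> \<Theta>\<close> the index set is nonempty,
  and the values lie in the closed unit interval, so the real \<open>Inf\<close> is the true infimum.
\<close>

definition profile_nuclear ::
  "(real \<Rightarrow> 'z \<Rightarrow> ('e \<times> 'x) set) \<Rightarrow> ('e \<times> 'x \<Rightarrow> 'u \<Rightarrow> 'z) \<Rightarrow> ('e \<times> 'x) set
    \<Rightarrow> 'u \<Rightarrow> 'e \<times> 'x \<Rightarrow> real" where
  "profile_nuclear \<Gamma> G \<Theta> u \<theta> =
     (INF \<xi>' \<in> {\<xi>'. (fst \<theta>, \<xi>') \<in> \<Theta>}. profile_level \<Gamma> G u (fst \<theta>) (snd \<theta>) \<xi>')"

definition Xi_set ::
  "('e \<times> 'x) set \<Rightarrow> 'u set \<Rightarrow> ('e \<times> 'x \<Rightarrow> 'u \<Rightarrow> 'z) \<Rightarrow> ('u \<Rightarrow> 'e \<times> 'x \<Rightarrow> real)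
    \<Rightarrow> real \<Rightarrow> 'z \<Rightarrow> 'e set" where
  "Xi_set \<Theta> \<U> G T\<^sub>P \<alpha> z =
     {\<eta>. \<exists>u\<in>\<U>. \<exists>\<xi>. (\<eta>, \<xi>) \<in> \<Theta> \<and> z = G (\<eta>, \<xi>) u \<and> T\<^sub>P u (\<eta>, \<xi>) \<le> \<alpha>}"

end

theory Submission
  imports Defs
begin

text \<open>
  Taking the true nuisance value as competitor in the infimum shows that \<open>T\<^sub>P (U, \<theta>\<^sub>0) \<le> \<alpha>\<close>
  whenever \<open>T\<^sub>a (U, \<theta>\<^sub>0) \<in> B \<alpha> \<theta>\<^sub>0\<close>. The latter event has probability at least \<open>\<alpha>\<close>, and on it
  \<open>u = U\<close>, \<open>\<xi> = \<xi>\<^sub>0\<close> witness membership of \<open>\<eta>\<^sub>0\<close> in the confidence set.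
\<close>

text \<open>Membership of \<open>a\<close> makes the set of levels nonempty, so the default value 1
  does not arise and the real \<open>Inf\<close> applies; the bound 0 from below makes that
  \<open>Inf\<close> meaningful.\<close>

lemma level_Inf_le:
  assumes "0 < a" "a < 1" "P a"
  shows "level_Inf P \<le> a"
proof -
  have "Inf {b. 0 < b \<and> b < 1 \<and> P b} \<le> a"
    using assms by (intro cInf_lower bdd_belowI[of _ 0]) auto
  then show ?thesis
    using assms by (auto simp: level_Inf_def Let_def)
qed

text \<open>Supplies the lower bound for the infimum over nuisance values. An empty set of levels
  gives 1, a nonempty one has only positive members.\<close>

lemma level_Inf_nonneg: "0 \<le> level_Inf P"
  by (auto simp: level_Inf_def Let_def intro!: cInf_greatest)

text \<open>The value \<open>\<xi>\<close> plays both roles, generating the data and competing in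
  the infimum, so any level \<open>a\<close> whose region contains the generating parameter is an
  upper bound.\<close>

lemma profile_nuclear_le:
  assumes "(\<eta>, \<xi>) \<in> \<Theta>" "(\<eta>, \<xi>) \<in> \<Gamma> a (G (\<eta>, \<xi>) u)" "0 < a" "a < 1"
  shows "profile_nuclear \<Gamma> G \<Theta> u (\<eta>, \<xi>) \<le> a"
proof -
  have "profile_nuclear \<Gamma> G \<Theta> u (\<eta>, \<xi>) \<le> profile_level \<Gamma> G u \<eta> \<xi> \<xi>"
    unfolding profile_nuclear_def fst_conv snd_conv
    \<comment> \<open>The reals are only conditionally complete, so besides \<open>\<xi>\<close>
      being in the index set a lower bound for all values is required; 0 serves.\<close>
    by (rule cINF_lower)
      (use assms in \<open>auto intro!: bdd_belowI[of _ 0] simp: profile_level_def level_Inf_nonneg\<close>)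
  also have "\<dots> \<le> a"
    unfolding profile_level_def using assms by (intro level_Inf_le)
  finally show ?thesis .
qed

theorem theorem3:
  fixes M :: "'a measure"
    and U :: "'a \<Rightarrow> real ^ 'r"
    and \<U> :: "(real ^ 'r) set"
    and \<Theta> :: "('e \<times> 'x) set"
    and \<Z> :: "'z set"
    and G :: "'e \<times> 'x \<Rightarrow> real ^ 'r \<Rightarrow> 'z"
    and g :: "'z \<Rightarrow> 'e \<times> 'x \<Rightarrow> real ^ 'r \<Rightarrow> real ^ 'k"
    and T\<^sub>a :: "real ^ 'r \<Rightarrow> 'e \<times> 'x \<Rightarrow> real ^ 'd"
    and B :: "real \<Rightarrow> 'e \<times> 'x \<Rightarrow> (real ^ 'd) set"
    and \<Gamma> :: "real \<Rightarrow> 'z \<Rightarrow> ('e \<times> 'x) set"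
    and \<eta>\<^sub>0 :: 'e and \<xi>\<^sub>0 :: 'x and \<alpha> :: real
  assumes "prob_space M"
    and U_meas: "U \<in> borel_measurable M"
    and U_in: "\<And>\<omega>. \<omega> \<in> space M \<Longrightarrow> U \<omega> \<in> \<U>"
    and G_in: "\<And>\<theta> u. \<theta> \<in> \<Theta> \<Longrightarrow> u \<in> \<U> \<Longrightarrow> G \<theta> u \<in> \<Z>"
    and B_borel: "\<And>\<alpha>' \<theta>. 0 < \<alpha>' \<Longrightarrow> \<alpha>' < 1 \<Longrightarrow> \<theta> \<in> \<Theta> \<Longrightarrow> B \<alpha>' \<theta> \<in> sets borel"
    and T_event: "\<And>\<alpha>' \<theta>. 0 < \<alpha>' \<Longrightarrow> \<alpha>' < 1 \<Longrightarrow> \<theta> \<in> \<Theta> \<Longrightarrow>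
           {\<omega> \<in> space M. T\<^sub>a (U \<omega>) \<theta> \<in> B \<alpha>' \<theta>} \<in> sets M"
    and coverage: "\<And>\<alpha>' \<theta>. 0 < \<alpha>' \<Longrightarrow> \<alpha>' < 1 \<Longrightarrow> \<theta> \<in> \<Theta> \<Longrightarrow>
           measure M {\<omega> \<in> space M. T\<^sub>a (U \<omega>) \<theta> \<in> B \<alpha>' \<theta>} \<ge> \<alpha>'"
    and Gamma: "\<Gamma> = Gamma_map \<Theta> \<U> G T\<^sub>a B
           \<or> (\<forall>\<theta>\<in>\<Theta>. \<forall>u\<in>\<U>. g (G \<theta> u) \<theta> u = 0) \<and> \<Gamma> = Gamma_eqn \<Theta> \<U> g T\<^sub>a B"
    and true_param: "(\<eta>\<^sub>0, \<xi>\<^sub>0) \<in> \<Theta>"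
    and level: "0 < \<alpha>" "\<alpha> < 1"
    and Xi_event: "{\<omega> \<in> space M. \<eta>\<^sub>0 \<in> Xi_set \<Theta> \<U> G (profile_nuclear \<Gamma> G \<Theta>) \<alpha> (G (\<eta>\<^sub>0, \<xi>\<^sub>0) (U \<omega>))} \<in> sets M"
  shows "measure M {\<omega> \<in> space M.
           \<eta>\<^sub>0 \<in> Xi_set \<Theta> \<U> G (profile_nuclear \<Gamma> G \<Theta>) \<alpha> (G (\<eta>\<^sub>0, \<xi>\<^sub>0) (U \<omega>))} \<ge> \<alpha>"
proof -
  interpret prob_space M by fact
  let ?E = "{\<omega> \<in> space M. T\<^sub>a (U \<omega>) (\<eta>\<^sub>0, \<xi>\<^sub>0) \<in> B \<alpha> (\<eta>\<^sub>0, \<xi>\<^sub>0)}"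
  let ?X = "{\<omega> \<in> space M.
    \<eta>\<^sub>0 \<in> Xi_set \<Theta> \<U> G (profile_nuclear \<Gamma> G \<Theta>) \<alpha> (G (\<eta>\<^sub>0, \<xi>\<^sub>0) (U \<omega>))}"
  have "?E \<subseteq> ?X"
  proof
    fix \<omega> assume \<omega>: "\<omega> \<in> ?E"
    then have u: "U \<omega> \<in> \<U>" by (simp add: U_in)
    have "(\<eta>\<^sub>0, \<xi>\<^sub>0) \<in> \<Gamma> \<alpha> (G (\<eta>\<^sub>0, \<xi>\<^sub>0) (U \<omega>))"
      \<comment> \<open>\<open>U \<omega>\<close> is the witness in both forms of
        \<open>\<Gamma>\<close>: the equation is reflexive for \<open>Gamma_map\<close>, and for
        \<open>Gamma_eqn\<close> it holds because \<open>g\<close> vanishes on generated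
        data.\<close>
      using Gamma \<omega> u true_param by (auto simp: Gamma_map_def Gamma_eqn_def intro!: bexI[of _ "U \<omega>"])
    then have "profile_nuclear \<Gamma> G \<Theta> (U \<omega>) (\<eta>\<^sub>0, \<xi>\<^sub>0) \<le> \<alpha>"
      using true_param level by (intro profile_nuclear_le)
    then show "\<omega> \<in> ?X"
      using \<omega> u true_param by (auto simp: Xi_set_def)
  qed
  then have "prob ?E \<le> prob ?X"
    \<comment> \<open>Monotonicity needs the larger event to be measurable, since
      \<open>measure\<close> is 0 on nonmeasurable sets.\<close>
    using Xi_event by (rule finite_measure_mono)
  then show ?thesis
    using coverage[OF level true_param] by linarith
qed

end
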